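(* A target–context functor $F\colon(\mathcal{C},T,C,\succeq)\to(\mathcal{C}',T',C',\succeq')$ maps universal simulators to universal simulators and singleton simulators to singleton simulators: if $s\colon P\otimes C\to T\otimes C$ is a universal (resp. singleton) simulator in $\mathcal{C}$, then $F(s)\colon F(P)\otimes C'\to T'\otimes C'$ is a universal (resp. singleton) simulator in $\mathcal{C}'$.
   Context: A gs-monoidal category is a symmetric monoidal category (tensor $\otimes$, unit $I$) whose objects carry commutative comonoids $\mathrm{copy}_A\colon A\to A\otimes A$, $\mathrm{del}_A\colon A\to I$ compatible with $\otimes$, with $\mathrm{del}_I=\mathrm{id}_I$. For $f\colon A\to X$: $\mathrm{dom}(f)=(\mathrm{id}_A\otimes(\mathrm{del}_X\circ f))\circ\mathrm{copy}_A$; normalized: $f\circ\mathrm{dom}(f)=f$; functional: $\mathrm{copy}_X\circ f=(f\otimes f)\circ\mathrm{copy}_A$. A target–context category $(\mathcal{C},T,C,\succeq)$ is a gs-monoidal category with all morphisms normalized, objects $T,C$ and a preorder $\succeq$ on each $\mathcal{C}(A,T\otimes C)$ with $f\circ\mathrm{dom}(g)=g\Rightarrow f\succeq g$ and $f\succeq g\Rightarrow f\circ h\succeq g\circ h$. A simulator with programs $P$: $s\colon P\otimes C\to T\otimes C$ such that there are a functional $s_T\colon P\to T$ (compiler) and $s_C\colon P\otimes C\to C$ with $s=(s_T\otimes s_C)\circ(\mathrm{copy}_P\otimes\mathrm{id}_C)$, $(\mathrm{id}_T\otimes\mathrm{del}_C)\circ s=s_T\otimes\mathrm{del}_C$, $(\mathrm{del}_T\otimes\mathrm{id}_C)\circ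 s=s_C$. It is universal if there is a functional $r\colon T\to P$ with $s\circ(r\otimes\mathrm{id}_C)\succeq\mathrm{id}_{T\otimes C}$, and singleton if $s_T=t\circ\mathrm{del}_P$ for a functional state $t\colon I\to T$. A target–context functor is a strong gs-monoidal functor $F\colon\mathcal{C}\to\mathcal{C}'$ (strong symmetric monoidal, sending $\mathrm{copy}_A,\mathrm{del}_A$ to $\mathrm{copy}_{FA},\mathrm{del}_{FA}$ up to coherence isomorphisms) with $F(T)=T'$, $F(C)=C'$ and $f\succeq g\Rightarrow F(f)\succeq'F(g)$ for all $f,g\colon A\to T\otimes C$. *)

theory Defs
  imports Main
begin

section \<open>Symmetric monoidal and gs-monoidal categories\<close>

record ('o, 'm) cat_data =
  Obj :: "'o set"
  Arr :: "'m set"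
  Dom :: "'m \<Rightarrow> 'o"
  Cod :: "'m \<Rightarrow> 'o"
  Id :: "'o \<Rightarrow> 'm"
  Comp :: "'m \<Rightarrow> 'm \<Rightarrow> 'm"  (infixr "\<cdot>\<index>" 70)

text \<open>Monoidal structure is not assumed strict. \<open>\<otimes>\<close> is the tensor of objects, \<open>\<boxtimes>\<close> that of morphisms;
  \<open>Assoc A B Z : (A \<otimes> B) \<otimes> Z \<rightarrow> A \<otimes> (B \<otimes> Z)\<close>, \<open>Lunit A : I \<otimes> A \<rightarrow> A\<close>,
  \<open>Runit A : A \<otimes> I \<rightarrow> A\<close>, \<open>Sym A B : A \<otimes> B \<rightarrow> B \<otimes> A\<close>.\<close>

record ('o, 'm) smc_data = "('o, 'm) cat_data" +
  TensorObj :: "'o \<Rightarrow> 'o \<Rightarrow> 'o"  (infixr "\<otimes>\<index>" 75)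
  TensorArr :: "'m \<Rightarrow> 'm \<Rightarrow> 'm"  (infixr "\<boxtimes>\<index>" 75)
  Unit :: 'o
  Assoc :: "'o \<Rightarrow> 'o \<Rightarrow> 'o \<Rightarrow> 'm"
  Lunit :: "'o \<Rightarrow> 'm"
  Runit :: "'o \<Rightarrow> 'm"
  Sym :: "'o \<Rightarrow> 'o \<Rightarrow> 'm"

record ('o, 'm) gs_data = "('o, 'm) smc_data" +
  Copy :: "'o \<Rightarrow> 'm"
  Del :: "'o \<Rightarrow> 'm"

definition hom :: "('o, 'm, 'x) cat_data_scheme \<Rightarrow> 'o \<Rightarrow> 'o \<Rightarrow> 'm set" where
  "hom C A B = {f \<in> Arr C. Dom C f = A \<and> Cod C f = B}"

definition inverse_arrows :: "('o, 'm, 'x) cat_data_scheme \<Rightarrow> 'm \<Rightarrow> 'm \<Rightarrow> bool" where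
  "inverse_arrows C f g \<longleftrightarrow> f \<in> Arr C \<and> g \<in> hom C (Cod C f) (Dom C f) \<and>
     g \<cdot>\<^bsub>C\<^esub> f = Id C (Dom C f) \<and> f \<cdot>\<^bsub>C\<^esub> g = Id C (Cod C f)"

definition iso_arr :: "('o, 'm, 'x) cat_data_scheme \<Rightarrow> 'm \<Rightarrow> bool" where
  "iso_arr C f \<longleftrightarrow> (\<exists>g. inverse_arrows C f g)"

definition inv_arr :: "('o, 'm, 'x) cat_data_scheme \<Rightarrow> 'm \<Rightarrow> 'm" where
  "inv_arr C f = (THE g. inverse_arrows C f g)"

locale category =
  fixes C :: "('o, 'm, 'x) cat_data_scheme" (structure)
  assumes Dom_Obj: "f \<in> Arr C \<Longrightarrow> Dom C f \<in> Obj C"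
    and Cod_Obj: "f \<in> Arr C \<Longrightarrow> Cod C f \<in> Obj C"
    and Id_hom: "A \<in> Obj C \<Longrightarrow> Id C A \<in> hom C A A"
    and Comp_hom: "\<lbrakk>f \<in> hom C X Y; g \<in> hom C Y Z\<rbrakk> \<Longrightarrow> g \<cdot> f \<in> hom C X Z"
    and Comp_Id: "f \<in> hom C X Y \<Longrightarrow> f \<cdot> Id C X = f"
    and Id_Comp: "f \<in> hom C X Y \<Longrightarrow> Id C Y \<cdot> f = f"
    and Comp_assoc: "\<lbrakk>f \<in> hom C W X; g \<in> hom C X Y; h \<in> hom C Y Z\<rbrakk>
      \<Longrightarrow> (h \<cdot> g) \<cdot> f = h \<cdot> (g \<cdot> f)"

locale symmetric_monoidal_category = category C
  for C :: "('o, 'm, 'x) smc_data_scheme" (structure) +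
  assumes Unit_Obj: "Unit C \<in> Obj C"
    and TensorObj_Obj: "\<lbrakk>A \<in> Obj C; B \<in> Obj C\<rbrakk> \<Longrightarrow> A \<otimes> B \<in> Obj C"
    and TensorArr_hom: "\<lbrakk>f \<in> hom C A A'; g \<in> hom C B B'\<rbrakk> \<Longrightarrow> f \<boxtimes> g \<in> hom C (A \<otimes> B) (A' \<otimes> B')"
    and Tensor_Id: "\<lbrakk>A \<in> Obj C; B \<in> Obj C\<rbrakk> \<Longrightarrow> Id C A \<boxtimes> Id C B = Id C (A \<otimes> B)"
    and Tensor_Comp: "\<lbrakk>f \<in> hom C A A'; f' \<in> hom C A' A''; g \<in> hom C B B'; g' \<in> hom C B' B''\<rbrakk>
      \<Longrightarrow> (f' \<cdot> f) \<boxtimes> (g' \<cdot> g) = (f' \<boxtimes> g') \<cdot> (f \<boxtimes> g)"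
    and Assoc_hom: "\<lbrakk>A \<in> Obj C; B \<in> Obj C; Z \<in> Obj C\<rbrakk>
      \<Longrightarrow> Assoc C A B Z \<in> hom C ((A \<otimes> B) \<otimes> Z) (A \<otimes> (B \<otimes> Z))"
    and Assoc_iso: "\<lbrakk>A \<in> Obj C; B \<in> Obj C; Z \<in> Obj C\<rbrakk> \<Longrightarrow> iso_arr C (Assoc C A B Z)"
    and Assoc_natural: "\<lbrakk>f \<in> hom C A A'; g \<in> hom C B B'; h \<in> hom C Z Z'\<rbrakk>
      \<Longrightarrow> Assoc C A' B' Z' \<cdot> ((f \<boxtimes> g) \<boxtimes> h) = (f \<boxtimes> (g \<boxtimes> h)) \<cdot> Assoc C A B Z"
    and Lunit_hom: "A \<in> Obj C \<Longrightarrow> Lunit C A \<in> hom C (Unit C \<otimes> A) A"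
    and Lunit_iso: "A \<in> Obj C \<Longrightarrow> iso_arr C (Lunit C A)"
    and Lunit_natural: "f \<in> hom C A A' \<Longrightarrow> Lunit C A' \<cdot> (Id C (Unit C) \<boxtimes> f) = f \<cdot> Lunit C A"
    and Runit_hom: "A \<in> Obj C \<Longrightarrow> Runit C A \<in> hom C (A \<otimes> Unit C) A"
    and Runit_iso: "A \<in> Obj C \<Longrightarrow> iso_arr C (Runit C A)"
    and Runit_natural: "f \<in> hom C A A' \<Longrightarrow> Runit C A' \<cdot> (f \<boxtimes> Id C (Unit C)) = f \<cdot> Runit C A"
    and Sym_hom: "\<lbrakk>A \<in> Obj C; B \<in> Obj C\<rbrakk> \<Longrightarrow> Sym C A B \<in> hom C (A \<otimes> B) (B \<otimes> A)"
    and Sym_natural: "\<lbrakk>f \<in> hom C A A'; g \<in> hom C B B'\<rbrakk>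
      \<Longrightarrow> Sym C A' B' \<cdot> (f \<boxtimes> g) = (g \<boxtimes> f) \<cdot> Sym C A B"
    and Sym_Sym: "\<lbrakk>A \<in> Obj C; B \<in> Obj C\<rbrakk> \<Longrightarrow> Sym C B A \<cdot> Sym C A B = Id C (A \<otimes> B)"
    and pentagon: "\<lbrakk>W \<in> Obj C; X \<in> Obj C; Y \<in> Obj C; Z \<in> Obj C\<rbrakk>
      \<Longrightarrow> Assoc C W X (Y \<otimes> Z) \<cdot> Assoc C (W \<otimes> X) Y Z =
          (Id C W \<boxtimes> Assoc C X Y Z) \<cdot> Assoc C W (X \<otimes> Y) Z \<cdot> (Assoc C W X Y \<boxtimes> Id C Z)"
    and triangle: "\<lbrakk>A \<in> Obj C; B \<in> Obj C\<rbrakk>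
      \<Longrightarrow> (Id C A \<boxtimes> Lunit C B) \<cdot> Assoc C A (Unit C) B = Runit C A \<boxtimes> Id C B"
    and hexagon: "\<lbrakk>X \<in> Obj C; Y \<in> Obj C; Z \<in> Obj C\<rbrakk>
      \<Longrightarrow> Assoc C Y Z X \<cdot> Sym C X (Y \<otimes> Z) \<cdot> Assoc C X Y Z =
          (Id C Y \<boxtimes> Sym C X Z) \<cdot> Assoc C Y X Z \<cdot> (Sym C X Y \<boxtimes> Id C Z)"

text \<open>The canonical isomorphism \<open>(A \<otimes> A) \<otimes> (B \<otimes> B) \<rightarrow> (A \<otimes> B) \<otimes> (A \<otimes> B)\<close> exchanging the two
  inner factors.\<close>

definition middle_swap :: "('o, 'm, 'x) smc_data_scheme \<Rightarrow> 'o \<Rightarrow> 'o \<Rightarrow> 'm" where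
  "middle_swap C A B =
     inv_arr C (Assoc C A B (A \<otimes>\<^bsub>C\<^esub> B)) \<cdot>\<^bsub>C\<^esub>
     (Id C A \<boxtimes>\<^bsub>C\<^esub> (Assoc C B A B \<cdot>\<^bsub>C\<^esub> (Sym C A B \<boxtimes>\<^bsub>C\<^esub> Id C B) \<cdot>\<^bsub>C\<^esub> inv_arr C (Assoc C A B B))) \<cdot>\<^bsub>C\<^esub>
     Assoc C A A (B \<otimes>\<^bsub>C\<^esub> B)"

text \<open>Compatibility of \<open>Copy\<close> with the unit, \<open>Lunit I \<cdot> Copy I = id\<close>, is the left counit law at \<open>I\<close>
  together with \<open>Del_Unit\<close>. Naturality of \<open>Copy\<close> and \<open>Del\<close> is not required.\<close>

locale gs_monoidal_category = symmetric_monoidal_category C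
  for C :: "('o, 'm, 'x) gs_data_scheme" (structure) +
  assumes Copy_hom: "A \<in> Obj C \<Longrightarrow> Copy C A \<in> hom C A (A \<otimes> A)"
    and Del_hom: "A \<in> Obj C \<Longrightarrow> Del C A \<in> hom C A (Unit C)"
    and Copy_coassoc: "A \<in> Obj C
      \<Longrightarrow> Assoc C A A A \<cdot> (Copy C A \<boxtimes> Id C A) \<cdot> Copy C A = (Id C A \<boxtimes> Copy C A) \<cdot> Copy C A"
    and Copy_lcounit: "A \<in> Obj C \<Longrightarrow> Lunit C A \<cdot> (Del C A \<boxtimes> Id C A) \<cdot> Copy C A = Id C A"
    and Copy_rcounit: "A \<in> Obj C \<Longrightarrow> Runit C A \<cdot> (Id C A \<boxtimes> Del C A) \<cdot> Copy C A = Id C A"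
    and Copy_comm: "A \<in> Obj C \<Longrightarrow> Sym C A A \<cdot> Copy C A = Copy C A"
    and Copy_Tensor: "\<lbrakk>A \<in> Obj C; B \<in> Obj C\<rbrakk>
      \<Longrightarrow> Copy C (A \<otimes> B) = middle_swap C A B \<cdot> (Copy C A \<boxtimes> Copy C B)"
    and Del_Tensor: "\<lbrakk>A \<in> Obj C; B \<in> Obj C\<rbrakk>
      \<Longrightarrow> Del C (A \<otimes> B) = Lunit C (Unit C) \<cdot> (Del C A \<boxtimes> Del C B)"
    and Del_Unit: "Del C (Unit C) = Id C (Unit C)"

definition gs_dom :: "('o, 'm, 'x) gs_data_scheme \<Rightarrow> 'm \<Rightarrow> 'm" where
  "gs_dom C f = Runit C (Dom C f) \<cdot>\<^bsub>C\<^esub>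
     (Id C (Dom C f) \<boxtimes>\<^bsub>C\<^esub> (Del C (Cod C f) \<cdot>\<^bsub>C\<^esub> f)) \<cdot>\<^bsub>C\<^esub> Copy C (Dom C f)"

definition normalized :: "('o, 'm, 'x) gs_data_scheme \<Rightarrow> 'm \<Rightarrow> bool" where
  "normalized C f \<longleftrightarrow> f \<cdot>\<^bsub>C\<^esub> gs_dom C f = f"

definition functional :: "('o, 'm, 'x) gs_data_scheme \<Rightarrow> 'm \<Rightarrow> bool" where
  "functional C f \<longleftrightarrow> Copy C (Cod C f) \<cdot>\<^bsub>C\<^esub> f = (f \<boxtimes>\<^bsub>C\<^esub> f) \<cdot>\<^bsub>C\<^esub> Copy C (Dom C f)"


section \<open>Target--context categories and simulators\<close>

text \<open>\<open>K\<close> is the context object. Only the values of \<open>\<succeq>\<close> on parallel morphisms into \<open>T \<otimes> K\<close>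
  matter.\<close>

locale target_context_category = gs_monoidal_category C
  for C :: "('o, 'm, 'x) gs_data_scheme" (structure)
    and T K :: 'o
    and geq :: "'m \<Rightarrow> 'm \<Rightarrow> bool"  (infix "\<succeq>" 50) +
  assumes all_normalized: "f \<in> Arr C \<Longrightarrow> normalized C f"
    and T_Obj: "T \<in> Obj C"
    and K_Obj: "K \<in> Obj C"
    and geq_refl: "A \<in> Obj C \<Longrightarrow> reflp_on (hom C A (T \<otimes> K)) (\<succeq>)"
    and geq_trans: "A \<in> Obj C \<Longrightarrow> transp_on (hom C A (T \<otimes> K)) (\<succeq>)"
    and geq_dom: "\<lbrakk>f \<in> hom C A (T \<otimes> K); g \<in> hom C A (T \<otimes> K); f \<cdot> gs_dom C g = g\<rbrakk> \<Longrightarrow> f \<succeq> g"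
    and geq_precomp: "\<lbrakk>f \<in> hom C A (T \<otimes> K); g \<in> hom C A (T \<otimes> K); h \<in> hom C Z A; f \<succeq> g\<rbrakk>
      \<Longrightarrow> f \<cdot> h \<succeq> g \<cdot> h"

text \<open>\<open>sT\<close> is a compiler of the simulator \<open>s\<close> and \<open>sC\<close> its context part.\<close>

definition simulator_parts ::
  "('o, 'm, 'x) gs_data_scheme \<Rightarrow> 'o \<Rightarrow> 'o \<Rightarrow> 'o \<Rightarrow> 'm \<Rightarrow> 'm \<Rightarrow> 'm \<Rightarrow> bool" where
  "simulator_parts C T K P s sT sC \<longleftrightarrow>
     P \<in> Obj C \<and>
     s \<in> hom C (P \<otimes>\<^bsub>C\<^esub> K) (T \<otimes>\<^bsub>C\<^esub> K) \<and>
     sT \<in> hom C P T \<and> functional C sT \<and>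
     sC \<in> hom C (P \<otimes>\<^bsub>C\<^esub> K) K \<and>
     s = (sT \<boxtimes>\<^bsub>C\<^esub> sC) \<cdot>\<^bsub>C\<^esub> Assoc C P P K \<cdot>\<^bsub>C\<^esub> (Copy C P \<boxtimes>\<^bsub>C\<^esub> Id C K) \<and>
     (Id C T \<boxtimes>\<^bsub>C\<^esub> Del C K) \<cdot>\<^bsub>C\<^esub> s = sT \<boxtimes>\<^bsub>C\<^esub> Del C K \<and>
     Lunit C K \<cdot>\<^bsub>C\<^esub> (Del C T \<boxtimes>\<^bsub>C\<^esub> Id C K) \<cdot>\<^bsub>C\<^esub> s = sC"

definition simulator :: "('o, 'm, 'x) gs_data_scheme \<Rightarrow> 'o \<Rightarrow> 'o \<Rightarrow> 'o \<Rightarrow> 'm \<Rightarrow> bool" where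
  "simulator C T K P s \<longleftrightarrow> (\<exists>sT sC. simulator_parts C T K P s sT sC)"

definition universal_simulator ::
  "('o, 'm, 'x) gs_data_scheme \<Rightarrow> 'o \<Rightarrow> 'o \<Rightarrow> ('m \<Rightarrow> 'm \<Rightarrow> bool) \<Rightarrow> 'o \<Rightarrow> 'm \<Rightarrow> bool" where
  "universal_simulator C T K geq P s \<longleftrightarrow> simulator C T K P s \<and>
     (\<exists>r. r \<in> hom C T P \<and> functional C r \<and>
          geq (s \<cdot>\<^bsub>C\<^esub> (r \<boxtimes>\<^bsub>C\<^esub> Id C K)) (Id C (T \<otimes>\<^bsub>C\<^esub> K)))"

definition singleton_simulator ::
  "('o, 'm, 'x) gs_data_scheme \<Rightarrow> 'o \<Rightarrow> 'o \<Rightarrow> 'o \<Rightarrow> 'm \<Rightarrow> bool" where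
  "singleton_simulator C T K P s \<longleftrightarrow>
     (\<exists>sT sC t. simulator_parts C T K P s sT sC \<and>
        t \<in> hom C (Unit C) T \<and> functional C t \<and> sT = t \<cdot>\<^bsub>C\<^esub> Del C P)"


section \<open>Strong gs-monoidal and target--context functors\<close>

text \<open>Coherence morphisms: \<open>mu F A B : F A \<otimes> F B \<rightarrow> F (A \<otimes> B)\<close> and \<open>eta F : I \<rightarrow> F I\<close>.\<close>

record ('o, 'm, 'p, 'n) functor_data =
  fobj :: "'o \<Rightarrow> 'p"
  farr :: "'m \<Rightarrow> 'n"
  mu :: "'o \<Rightarrow> 'o \<Rightarrow> 'n"
  eta :: 'n

locale strong_symmetric_monoidal_functor =
  source: symmetric_monoidal_category C + target: symmetric_monoidal_category C'
  for C :: "('o, 'm, 'x) smc_data_scheme"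
    and C' :: "('p, 'n, 'y) smc_data_scheme"
    and F :: "('o, 'm, 'p, 'n) functor_data" +
  assumes fobj_Obj: "A \<in> Obj C \<Longrightarrow> fobj F A \<in> Obj C'"
    and farr_hom: "f \<in> hom C A B \<Longrightarrow> farr F f \<in> hom C' (fobj F A) (fobj F B)"
    and farr_Id: "A \<in> Obj C \<Longrightarrow> farr F (Id C A) = Id C' (fobj F A)"
    and farr_Comp: "\<lbrakk>f \<in> hom C X Y; g \<in> hom C Y Z\<rbrakk>
      \<Longrightarrow> farr F (g \<cdot>\<^bsub>C\<^esub> f) = farr F g \<cdot>\<^bsub>C'\<^esub> farr F f"
    and mu_hom: "\<lbrakk>A \<in> Obj C; B \<in> Obj C\<rbrakk>
      \<Longrightarrow> mu F A B \<in> hom C' (fobj F A \<otimes>\<^bsub>C'\<^esub> fobj F B) (fobj F (A \<otimes>\<^bsub>C\<^esub> B))"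
    and mu_iso: "\<lbrakk>A \<in> Obj C; B \<in> Obj C\<rbrakk> \<Longrightarrow> iso_arr C' (mu F A B)"
    and mu_natural: "\<lbrakk>f \<in> hom C A A'; g \<in> hom C B B'\<rbrakk>
      \<Longrightarrow> farr F (f \<boxtimes>\<^bsub>C\<^esub> g) \<cdot>\<^bsub>C'\<^esub> mu F A B = mu F A' B' \<cdot>\<^bsub>C'\<^esub> (farr F f \<boxtimes>\<^bsub>C'\<^esub> farr F g)"
    and eta_hom: "eta F \<in> hom C' (Unit C') (fobj F (Unit C))"
    and eta_iso: "iso_arr C' (eta F)"
    and mu_Assoc: "\<lbrakk>X \<in> Obj C; Y \<in> Obj C; Z \<in> Obj C\<rbrakk>
      \<Longrightarrow> farr F (Assoc C X Y Z) \<cdot>\<^bsub>C'\<^esub> mu F (X \<otimes>\<^bsub>C\<^esub> Y) Z \<cdot>\<^bsub>C'\<^esub> (mu F X Y \<boxtimes>\<^bsub>C'\<^esub> Id C' (fobj F Z)) =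
          mu F X (Y \<otimes>\<^bsub>C\<^esub> Z) \<cdot>\<^bsub>C'\<^esub> (Id C' (fobj F X) \<boxtimes>\<^bsub>C'\<^esub> mu F Y Z) \<cdot>\<^bsub>C'\<^esub>
            Assoc C' (fobj F X) (fobj F Y) (fobj F Z)"
    and mu_Lunit: "A \<in> Obj C
      \<Longrightarrow> farr F (Lunit C A) \<cdot>\<^bsub>C'\<^esub> mu F (Unit C) A \<cdot>\<^bsub>C'\<^esub> (eta F \<boxtimes>\<^bsub>C'\<^esub> Id C' (fobj F A)) =
          Lunit C' (fobj F A)"
    and mu_Runit: "A \<in> Obj C
      \<Longrightarrow> farr F (Runit C A) \<cdot>\<^bsub>C'\<^esub> mu F A (Unit C) \<cdot>\<^bsub>C'\<^esub> (Id C' (fobj F A) \<boxtimes>\<^bsub>C'\<^esub> eta F) =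
          Runit C' (fobj F A)"
    and mu_Sym: "\<lbrakk>A \<in> Obj C; B \<in> Obj C\<rbrakk>
      \<Longrightarrow> farr F (Sym C A B) \<cdot>\<^bsub>C'\<^esub> mu F A B = mu F B A \<cdot>\<^bsub>C'\<^esub> Sym C' (fobj F A) (fobj F B)"

locale strong_gs_monoidal_functor =
  strong_symmetric_monoidal_functor C C' F +
  source: gs_monoidal_category C + target: gs_monoidal_category C'
  for C :: "('o, 'm, 'x) gs_data_scheme"
    and C' :: "('p, 'n, 'y) gs_data_scheme"
    and F :: "('o, 'm, 'p, 'n) functor_data" +
  assumes farr_Copy: "A \<in> Obj C \<Longrightarrow> farr F (Copy C A) = mu F A A \<cdot>\<^bsub>C'\<^esub> Copy C' (fobj F A)"
    and farr_Del: "A \<in> Obj C \<Longrightarrow> farr F (Del C A) = eta F \<cdot>\<^bsub>C'\<^esub> Del C' (fobj F A)"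

text \<open>Since \<open>F (T \<otimes> K)\<close> and \<open>T' \<otimes> K'\<close> are only isomorphic, the relation \<open>\<succeq>'\<close> is applied to
  \<open>F f\<close> after composing with the inverse of \<open>mu F T K\<close>.\<close>

locale target_context_functor =
  strong_gs_monoidal_functor C C' F +
  source: target_context_category C T K geq + target: target_context_category C' T' K' geq'
  for C :: "('o, 'm, 'x) gs_data_scheme"
    and T K :: 'o
    and geq :: "'m \<Rightarrow> 'm \<Rightarrow> bool"
    and C' :: "('p, 'n, 'y) gs_data_scheme"
    and T' K' :: 'p
    and geq' :: "'n \<Rightarrow> 'n \<Rightarrow> bool"
    and F :: "('o, 'm, 'p, 'n) functor_data" +
  assumes fobj_T: "fobj F T = T'"
    and fobj_K: "fobj F K = K'"
    and farr_geq: "\<lbrakk>f \<in> hom C A (T \<otimes>\<^bsub>C\<^esub> K); g \<in> hom C A (T \<otimes>\<^bsub>C\<^esub> K); geq f g\<rbrakk>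
      \<Longrightarrow> geq' (inv_arr C' (mu F T K) \<cdot>\<^bsub>C'\<^esub> farr F f) (inv_arr C' (mu F T K) \<cdot>\<^bsub>C'\<^esub> farr F g)"

text \<open>\<open>F s\<close> read as a morphism \<open>F P \<otimes> K' \<rightarrow> T' \<otimes> K'\<close> along the coherence isomorphisms of \<open>F\<close>.\<close>

definition simulator_image ::
  "('p, 'n, 'y) gs_data_scheme \<Rightarrow> ('o, 'm, 'p, 'n) functor_data \<Rightarrow> 'o \<Rightarrow> 'o \<Rightarrow> 'o \<Rightarrow> 'm \<Rightarrow> 'n" where
  "simulator_image C' F T K P s = inv_arr C' (mu F T K) \<cdot>\<^bsub>C'\<^esub> farr F s \<cdot>\<^bsub>C'\<^esub> mu F P K"

end

(* The compiler of the image simulator is F sT and its context part is F sC precomposed with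
   mu P K. Each defining equation, prefixed with the appropriate mu (and eta), becomes F of the
   corresponding equation in the source category by naturality and coherence of mu, and the prefix
   cancels because it is invertible. If r witnesses universality of s, then F r witnesses it for the
   image. A singleton compiler t o del goes to (F t o eta) o del', so what remains is that eta is
   functional. *)
theory Submission
  imports Defs
begin

text \<open>Splits hom-set typing into \<open>Arr\<close>, \<open>Dom\<close> and \<open>Cod\<close>
  facts. With the \<open>_simps\<close> rules stated in this form, the simplifier computes the type
  of a composite without guessing intermediate objects.\<close>

lemma hom_iff: "f \<in> hom C A B \<longleftrightarrow> f \<in> Arr C \<and> Dom C f = A \<and> Cod C f = B"
  by (simp add: hom_def)

section \<open>Composition and inverses in a category\<close>

context category
begin

lemma Id_simps [simp]:
  assumes "A \<in> Obj C"
  shows "Id C A \<in> Arr C" "Dom C (Id C A) = A" "Cod C (Id C A) = A"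
  using Id_hom[OF assms] by (simp_all add: hom_iff)

lemma Comp_simps [simp]:
  assumes "f \<in> Arr C" "g \<in> Arr C" "Cod C f = Dom C g"
  shows "g \<cdot> f \<in> Arr C" "Dom C (g \<cdot> f) = Dom C f" "Cod C (g \<cdot> f) = Cod C g"
  using Comp_hom[of f "Dom C f" "Cod C f" g "Cod C g"] assms by (simp_all add: hom_iff)

lemma Comp_Id_eq [simp]: "f \<in> Arr C \<Longrightarrow> Dom C f = A \<Longrightarrow> f \<cdot> Id C A = f"
  using Comp_Id[of f A "Cod C f"] by (simp add: hom_iff)

lemma Id_Comp_eq [simp]: "f \<in> Arr C \<Longrightarrow> Cod C f = A \<Longrightarrow> Id C A \<cdot> f = f"
  using Id_Comp[of f "Dom C f" A] by (simp add: hom_iff)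

lemma Comp_assoc_eq [simp]:
  assumes "f \<in> Arr C" "g \<in> Arr C" "h \<in> Arr C" "Cod C f = Dom C g" "Cod C g = Dom C h"
  shows "(h \<cdot> g) \<cdot> f = h \<cdot> g \<cdot> f"
  using Comp_assoc[of f "Dom C f" "Cod C f" g "Cod C g" h "Cod C h"] assms
  by (simp add: hom_iff)

text \<open>Turns an equation between composites into a rewrite rule that applies inside a
  right-associated chain.\<close>

lemma Comp_eq_extend:
  assumes "g \<cdot> f = k" "f \<in> Arr C" "g \<in> Arr C" "Cod C f = Dom C g"
    and "x \<in> Arr C" "Cod C x = Dom C f"
  shows "g \<cdot> f \<cdot> x = k \<cdot> x"
  using assms Comp_assoc_eq[of x f g] by simp

text \<open>Bracket \<open>g \<cdot> f \<cdot> h\<close> in both ways. Uniqueness makes the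
  description behind \<open>inv_arr\<close> well defined.\<close>

lemma inverse_arrows_unique:
  assumes "inverse_arrows C f g" "inverse_arrows C f h"
  shows "g = h"
proof -
  have "g = g \<cdot> (f \<cdot> h)"
    using assms by (simp add: inverse_arrows_def hom_iff)
  also have "\<dots> = (g \<cdot> f) \<cdot> h"
    using assms by (subst Comp_assoc_eq) (simp_all add: inverse_arrows_def hom_iff)
  also have "\<dots> = h"
    using assms by (simp add: inverse_arrows_def hom_iff)
  finally show ?thesis .
qed

lemma inverse_arrows_inv_arr:
  assumes "iso_arr C f"
  shows "inverse_arrows C f (inv_arr C f)"
  unfolding inv_arr_def
  using assms inverse_arrows_unique unfolding iso_arr_def by (metis theI)

lemma inv_arr_simps:
  assumes "iso_arr C f"
  shows "inv_arr C f \<in> Arr C" "Dom C (inv_arr C f) = Cod C f" "Cod C (inv_arr C f) = Dom C f"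
    "inv_arr C f \<cdot> f = Id C (Dom C f)" "f \<cdot> inv_arr C f = Id C (Cod C f)"
  using inverse_arrows_inv_arr[OF assms] by (simp_all add: inverse_arrows_def hom_iff)

lemma iso_arr_Arr: "iso_arr C f \<Longrightarrow> f \<in> Arr C"
  by (auto simp: iso_arr_def inverse_arrows_def)

text \<open>Composing with \<open>inv_arr C m\<close> shows that isomorphisms are monic. Several
  equations about images under \<open>F\<close> are first proved behind an invertible prefix such as
  \<open>mu\<close>, which this rule removes.\<close>

lemma iso_cancel_left:
  assumes "m \<cdot> f = m \<cdot> g" "iso_arr C m" "f \<in> Arr C" "g \<in> Arr C"
    and "Cod C f = Dom C m" "Cod C g = Dom C m"
  shows "f = g"
proof -
  have "m \<in> Arr C" using assms(2) by (rule iso_arr_Arr)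
  have "f = (inv_arr C m \<cdot> m) \<cdot> f"
    using assms by (simp add: inv_arr_simps)
  also have "\<dots> = inv_arr C m \<cdot> (m \<cdot> f)"
    using assms \<open>m \<in> Arr C\<close> by (intro Comp_assoc_eq) (simp_all add: inv_arr_simps)
  also have "\<dots> = (inv_arr C m \<cdot> m) \<cdot> g"
    unfolding \<open>m \<cdot> f = m \<cdot> g\<close>
    using assms \<open>m \<in> Arr C\<close> by (intro Comp_assoc_eq[symmetric]) (simp_all add: inv_arr_simps)
  also have "\<dots> = g"
    using assms by (simp add: inv_arr_simps)
  finally show ?thesis .
qed

lemma iso_arr_Id: "A \<in> Obj C \<Longrightarrow> iso_arr C (Id C A)"
  by (auto simp: iso_arr_def inverse_arrows_def hom_iff intro!: exI[of _ "Id C A"])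

end

section \<open>Interchange and invertibility in a symmetric monoidal category\<close>

context symmetric_monoidal_category
begin

lemmas Unit_Obj [simp] and TensorObj_Obj [simp]

lemma TensorArr_simps [simp]:
  assumes "f \<in> Arr C" "g \<in> Arr C"
  shows "f \<boxtimes> g \<in> Arr C" "Dom C (f \<boxtimes> g) = Dom C f \<otimes> Dom C g"
    "Cod C (f \<boxtimes> g) = Cod C f \<otimes> Cod C g"
  using TensorArr_hom[of f "Dom C f" "Cod C f" g "Dom C g" "Cod C g"] assms
  by (simp_all add: hom_iff)

lemma Assoc_simps [simp]:
  assumes "A \<in> Obj C" "B \<in> Obj C" "Z \<in> Obj C"
  shows "Assoc C A B Z \<in> Arr C" "Dom C (Assoc C A B Z) = (A \<otimes> B) \<otimes> Z"
    "Cod C (Assoc C A B Z) = A \<otimes> (B \<otimes> Z)"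
  using Assoc_hom[OF assms] by (simp_all add: hom_iff)

lemma Lunit_simps [simp]:
  assumes "A \<in> Obj C"
  shows "Lunit C A \<in> Arr C" "Dom C (Lunit C A) = Unit C \<otimes> A" "Cod C (Lunit C A) = A"
  using Lunit_hom[OF assms] by (simp_all add: hom_iff)

lemma Lunit_natural_eq:
  "f \<in> Arr C \<Longrightarrow> Lunit C (Cod C f) \<cdot> (Id C (Unit C) \<boxtimes> f) = f \<cdot> Lunit C (Dom C f)"
  using Lunit_natural[of f "Dom C f" "Cod C f"] by (simp add: hom_iff)

text \<open>Interchange, oriented so that consecutive tensors merge and can be simplified factor by
  factor.\<close>

lemma Tensor_Comp_eq:
  assumes "f \<in> Arr C" "f' \<in> Arr C" "g \<in> Arr C" "g' \<in> Arr C"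
    and "Cod C f = Dom C f'" "Cod C g = Dom C g'"
  shows "(f' \<boxtimes> g') \<cdot> (f \<boxtimes> g) = (f' \<cdot> f) \<boxtimes> (g' \<cdot> g)"
  using Tensor_Comp[of f "Dom C f" "Cod C f" f' "Cod C f'" g "Dom C g" "Cod C g" g' "Cod C g'"] assms
  by (simp add: hom_iff)

text \<open>By interchange, the tensor of the inverses is an inverse. This allows a tensor of an
  identity with \<open>eta\<close> to be cancelled.\<close>

lemma iso_arr_Tensor:
  assumes "iso_arr C f" "iso_arr C g"
  shows "iso_arr C (f \<boxtimes> g)"
  unfolding iso_arr_def
proof
  have "f \<in> Arr C" "g \<in> Arr C" using assms by (simp_all add: iso_arr_Arr)
  then show "inverse_arrows C (f \<boxtimes> g) (inv_arr C f \<boxtimes> inv_arr C g)"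
    using assms
    by (simp add: inverse_arrows_def hom_iff inv_arr_simps Tensor_Comp_eq Tensor_Id Dom_Obj Cod_Obj)
qed

end

section \<open>Copying, deleting and functional morphisms\<close>

context gs_monoidal_category
begin

lemma Copy_simps [simp]:
  assumes "A \<in> Obj C"
  shows "Copy C A \<in> Arr C" "Dom C (Copy C A) = A" "Cod C (Copy C A) = A \<otimes> A"
  using Copy_hom[OF assms] by (simp_all add: hom_iff)

lemma Del_simps [simp]:
  assumes "A \<in> Obj C"
  shows "Del C A \<in> Arr C" "Dom C (Del C A) = A" "Cod C (Del C A) = Unit C"
  using Del_hom[OF assms] by (simp_all add: hom_iff)

text \<open>The left counit law at the unit object: there \<open>Del\<close> is an identity, so the
  middle factor disappears.\<close>

lemma Lunit_Copy_Unit: "Lunit C (Unit C) \<cdot> Copy C (Unit C) = Id C (Unit C)"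
  using Copy_lcounit[of "Unit C"] by (simp add: Del_Unit Tensor_Id)

text \<open>\<open>Copy\<close> slides past \<open>g\<close>, then past \<open>f\<close>, and
  interchange merges the two doubled arrows.\<close>

lemma functional_Comp:
  assumes "functional C f" "functional C g" "f \<in> Arr C" "g \<in> Arr C" "Cod C f = Dom C g"
  shows "functional C (g \<cdot> f)"
proof -
  have f: "Copy C (Dom C g) \<cdot> f = (f \<boxtimes> f) \<cdot> Copy C (Dom C f)"
    and g: "Copy C (Cod C g) \<cdot> g = (g \<boxtimes> g) \<cdot> Copy C (Dom C g)"
    using assms by (simp_all add: functional_def)
  have "Copy C (Cod C g) \<cdot> g \<cdot> f = (g \<boxtimes> g) \<cdot> (f \<boxtimes> f) \<cdot> Copy C (Dom C f)"
    using assms by (simp add: Comp_eq_extend[OF g] f Dom_Obj Cod_Obj)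
  also have "\<dots> = ((g \<cdot> f) \<boxtimes> (g \<cdot> f)) \<cdot> Copy C (Dom C f)"
    using assms by (simp add: Comp_eq_extend[OF Tensor_Comp_eq] Dom_Obj)
  finally show ?thesis
    using assms by (simp add: functional_def)
qed

end

section \<open>Strong symmetric monoidal functors\<close>

context strong_symmetric_monoidal_functor
begin

lemmas fobj_Obj [simp]

lemma farr_simps [simp]:
  assumes "f \<in> Arr C"
  shows "farr F f \<in> Arr C'" "Dom C' (farr F f) = fobj F (Dom C f)"
    "Cod C' (farr F f) = fobj F (Cod C f)"
  using farr_hom[of f "Dom C f" "Cod C f"] assms by (simp_all add: hom_iff)

lemma mu_simps [simp]:
  assumes "A \<in> Obj C" "B \<in> Obj C"
  shows "mu F A B \<in> Arr C'" "Dom C' (mu F A B) = fobj F A \<otimes>\<^bsub>C'\<^esub> fobj F B"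
    "Cod C' (mu F A B) = fobj F (A \<otimes>\<^bsub>C\<^esub> B)"
  using mu_hom[OF assms] by (simp_all add: hom_iff)

lemma eta_simps [simp]:
  "eta F \<in> Arr C'" "Dom C' (eta F) = Unit C'" "Cod C' (eta F) = fobj F (Unit C)"
  using eta_hom by (simp_all add: hom_iff)

text \<open>Functoriality oriented to collect a chain under one \<open>farr\<close>; the symmetric
  form expands it again.\<close>

lemma farr_Comp_eq:
  "\<lbrakk>f \<in> Arr C; g \<in> Arr C; Cod C f = Dom C g\<rbrakk> \<Longrightarrow> farr F g \<cdot>\<^bsub>C'\<^esub> farr F f = farr F (g \<cdot>\<^bsub>C\<^esub> f)"
  using farr_Comp[of f "Dom C f" "Cod C f" g "Cod C g"] by (simp add: hom_iff)

lemma mu_natural_eq: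
  assumes "f \<in> Arr C" "g \<in> Arr C" "Dom C f = A" "Dom C g = B"
  shows "farr F (f \<boxtimes>\<^bsub>C\<^esub> g) \<cdot>\<^bsub>C'\<^esub> mu F A B
    = mu F (Cod C f) (Cod C g) \<cdot>\<^bsub>C'\<^esub> (farr F f \<boxtimes>\<^bsub>C'\<^esub> farr F g)"
  using assms by (intro mu_natural) (simp_all add: hom_iff)

lemma farr_iso_arr:
  assumes "iso_arr C f"
  shows "iso_arr C' (farr F f)"
  unfolding iso_arr_def
proof
  have "f \<in> Arr C" using assms by (rule source.iso_arr_Arr)
  then show "inverse_arrows C' (farr F f) (farr F (inv_arr C f))"
    using assms
    by (simp add: inverse_arrows_def hom_iff source.inv_arr_simps farr_Comp_eq farr_Id
        source.Dom_Obj source.Cod_Obj)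
qed

end

section \<open>Strong gs-monoidal functors and images of simulators\<close>

context strong_gs_monoidal_functor
begin

text \<open>Under \<open>farr_Copy\<close>, the image of the functionality equation acquires a
  \<open>mu\<close> on each side. Naturality moves the one on the right to the front, and both
  cancel.\<close>

lemma functional_farr:
  assumes f: "functional C f" "f \<in> Arr C"
  shows "functional C' (farr F f)"
proof -
  let ?A = "Dom C f" and ?B = "Cod C f"
  have [simp]: "?A \<in> Obj C" "?B \<in> Obj C"
    using f by (simp_all add: source.Dom_Obj source.Cod_Obj)
  have "mu F ?B ?B \<cdot>\<^bsub>C'\<^esub> Copy C' (fobj F ?B) \<cdot>\<^bsub>C'\<^esub> farr F f
      = farr F (Copy C ?B \<cdot>\<^bsub>C\<^esub> f)"
    using f by (simp add: farr_Comp_eq[symmetric] farr_Copy)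
  also have "\<dots> = farr F (f \<boxtimes>\<^bsub>C\<^esub> f) \<cdot>\<^bsub>C'\<^esub> mu F ?A ?A \<cdot>\<^bsub>C'\<^esub> Copy C' (fobj F ?A)"
    using f by (simp add: functional_def farr_Comp_eq[symmetric] farr_Copy)
  also have "\<dots> = mu F ?B ?B \<cdot>\<^bsub>C'\<^esub> (farr F f \<boxtimes>\<^bsub>C'\<^esub> farr F f) \<cdot>\<^bsub>C'\<^esub> Copy C' (fobj F ?A)"
    using f by (simp add: target.Comp_eq_extend[OF mu_natural_eq])
  finally have "Copy C' (fobj F ?B) \<cdot>\<^bsub>C'\<^esub> farr F f
      = (farr F f \<boxtimes>\<^bsub>C'\<^esub> farr F f) \<cdot>\<^bsub>C'\<^esub> Copy C' (fobj F ?A)"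
    by (rule target.iso_cancel_left) (use f in \<open>simp_all add: mu_iso\<close>)
  then show ?thesis
    using f by (simp add: functional_def)
qed

text \<open>Both sides of the functionality equation for \<open>eta\<close> become \<open>eta\<close> after composition with the
  isomorphism \<open>F (Lunit I) \<cdot> mu I I\<close>, since \<open>Copy I\<close> is inverse to \<open>Lunit I\<close> in either category.\<close>

lemma functional_eta: "functional C' (eta F)"
proof -
  let ?I = "Unit C" and ?J = "Unit C'"
  let ?L = "farr F (Lunit C ?I)"
  \<comment> \<open>With this splitting, \<open>mu_Lunit\<close> absorbs the first factor and
    naturality of \<open>Lunit\<close> handles the second.\<close>
  have eta_eta: "eta F \<boxtimes>\<^bsub>C'\<^esub> eta F
      = (eta F \<boxtimes>\<^bsub>C'\<^esub> Id C' (fobj F ?I)) \<cdot>\<^bsub>C'\<^esub> (Id C' ?J \<boxtimes>\<^bsub>C'\<^esub> eta F)"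
    by (simp add: target.Tensor_Comp_eq)
  have mu_L: "?L \<cdot>\<^bsub>C'\<^esub> mu F ?I ?I \<cdot>\<^bsub>C'\<^esub> (eta F \<boxtimes>\<^bsub>C'\<^esub> eta F)
      = eta F \<cdot>\<^bsub>C'\<^esub> Lunit C' ?J"
  proof -
    have "?L \<cdot>\<^bsub>C'\<^esub> mu F ?I ?I \<cdot>\<^bsub>C'\<^esub> (eta F \<boxtimes>\<^bsub>C'\<^esub> eta F)
      = (?L \<cdot>\<^bsub>C'\<^esub> mu F ?I ?I \<cdot>\<^bsub>C'\<^esub> (eta F \<boxtimes>\<^bsub>C'\<^esub> Id C' (fobj F ?I)))
          \<cdot>\<^bsub>C'\<^esub> (Id C' ?J \<boxtimes>\<^bsub>C'\<^esub> eta F)"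
      unfolding eta_eta by simp
    also have "\<dots> = eta F \<cdot>\<^bsub>C'\<^esub> Lunit C' ?J"
      using target.Lunit_natural_eq[of "eta F"] by (simp only: mu_Lunit source.Unit_Obj) simp
    finally show ?thesis .
  qed
  \<comment> \<open>The \<open>mu\<close> in the prefix is the one produced by
    \<open>farr_Copy\<close>, so the left side contains the image of \<open>Lunit\<close> after
    \<open>Copy\<close> at the unit, which is an identity.\<close>
  have "?L \<cdot>\<^bsub>C'\<^esub> mu F ?I ?I \<cdot>\<^bsub>C'\<^esub> (Copy C' (fobj F ?I) \<cdot>\<^bsub>C'\<^esub> eta F)
      = farr F (Lunit C ?I \<cdot>\<^bsub>C\<^esub> Copy C ?I) \<cdot>\<^bsub>C'\<^esub> eta F"
    by (simp add: farr_Comp_eq[symmetric] farr_Copy)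
  also have "\<dots> = eta F \<cdot>\<^bsub>C'\<^esub> (Lunit C' ?J \<cdot>\<^bsub>C'\<^esub> Copy C' ?J)"
    by (simp add: source.Lunit_Copy_Unit target.Lunit_Copy_Unit farr_Id)
  also have "\<dots> = (?L \<cdot>\<^bsub>C'\<^esub> mu F ?I ?I \<cdot>\<^bsub>C'\<^esub> (eta F \<boxtimes>\<^bsub>C'\<^esub> eta F)) \<cdot>\<^bsub>C'\<^esub> Copy C' ?J"
    unfolding mu_L by simp
  also have "\<dots> = ?L \<cdot>\<^bsub>C'\<^esub> mu F ?I ?I \<cdot>\<^bsub>C'\<^esub> ((eta F \<boxtimes>\<^bsub>C'\<^esub> eta F) \<cdot>\<^bsub>C'\<^esub> Copy C' ?J)"
    by simp
  \<comment> \<open>The prefix is removed in two stages: first the image of \<open>Lunit\<close>,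
    then \<open>mu\<close>.\<close>
  finally have "mu F ?I ?I \<cdot>\<^bsub>C'\<^esub> (Copy C' (fobj F ?I) \<cdot>\<^bsub>C'\<^esub> eta F)
      = mu F ?I ?I \<cdot>\<^bsub>C'\<^esub> ((eta F \<boxtimes>\<^bsub>C'\<^esub> eta F) \<cdot>\<^bsub>C'\<^esub> Copy C' ?J)"
    by (rule target.iso_cancel_left) (simp_all add: farr_iso_arr source.Lunit_iso)
  then have "Copy C' (fobj F ?I) \<cdot>\<^bsub>C'\<^esub> eta F
      = (eta F \<boxtimes>\<^bsub>C'\<^esub> eta F) \<cdot>\<^bsub>C'\<^esub> Copy C' ?J"
    by (rule target.iso_cancel_left) (simp_all add: mu_iso)
  then show ?thesis
    by (simp add: functional_def)
qed

text \<open>The last fact avoids inverses and, since \<open>mu\<close> is monic, determines the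
  image. The transfer of simulator parts uses only it and the typing facts.\<close>

lemma simulator_image_simps:
  assumes "T \<in> Obj C" "K \<in> Obj C" "P \<in> Obj C" "s \<in> hom C (P \<otimes>\<^bsub>C\<^esub> K) (T \<otimes>\<^bsub>C\<^esub> K)"
  shows "simulator_image C' F T K P s \<in> Arr C'"
    "Dom C' (simulator_image C' F T K P s) = fobj F P \<otimes>\<^bsub>C'\<^esub> fobj F K"
    "Cod C' (simulator_image C' F T K P s) = fobj F T \<otimes>\<^bsub>C'\<^esub> fobj F K"
    "mu F T K \<cdot>\<^bsub>C'\<^esub> simulator_image C' F T K P s = farr F s \<cdot>\<^bsub>C'\<^esub> mu F P K"
proof -
  note inv = target.inv_arr_simps[OF mu_iso[OF assms(1,2)]]
  have s: "s \<in> Arr C" "Dom C s = P \<otimes>\<^bsub>C\<^esub> K" "Cod C s = T \<otimes>\<^bsub>C\<^esub> K"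
    using assms(4) by (simp_all add: hom_iff)
  show "simulator_image C' F T K P s \<in> Arr C'"
    "Dom C' (simulator_image C' F T K P s) = fobj F P \<otimes>\<^bsub>C'\<^esub> fobj F K"
    "Cod C' (simulator_image C' F T K P s) = fobj F T \<otimes>\<^bsub>C'\<^esub> fobj F K"
    using assms(1-3) s inv by (simp_all add: simulator_image_def)
  show "mu F T K \<cdot>\<^bsub>C'\<^esub> simulator_image C' F T K P s = farr F s \<cdot>\<^bsub>C'\<^esub> mu F P K"
    using assms(1-3) s inv
    by (simp add: simulator_image_def target.Comp_eq_extend[OF inv(5)])
qed

text \<open>Compiler and context part are described by gs-monoidal structure alone, so the transfer
  takes place at this level. The objects \<open>fobj F T\<close> and \<open>fobj F K\<close> are
  later identified with \<open>T'\<close> and \<open>K'\<close>.\<close>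

lemma simulator_parts_image:
  assumes TK: "T \<in> Obj C" "K \<in> Obj C" and parts: "simulator_parts C T K P s sT sC"
  shows "simulator_parts C' (fobj F T) (fobj F K) (fobj F P) (simulator_image C' F T K P s)
    (farr F sT) (farr F sC \<cdot>\<^bsub>C'\<^esub> mu F P K)"
proof -
  let ?s = "simulator_image C' F T K P s"
  let ?T = "fobj F T" and ?K = "fobj F K" and ?P = "fobj F P"
  have P: "P \<in> Obj C" and s_hom: "s \<in> hom C (P \<otimes>\<^bsub>C\<^esub> K) (T \<otimes>\<^bsub>C\<^esub> K)"
    and sT: "sT \<in> Arr C" "Dom C sT = P" "Cod C sT = T" "functional C sT"
    and sC: "sC \<in> Arr C" "Dom C sC = P \<otimes>\<^bsub>C\<^esub> K" "Cod C sC = K"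
    and s_eq: "s = (sT \<boxtimes>\<^bsub>C\<^esub> sC) \<cdot>\<^bsub>C\<^esub> Assoc C P P K \<cdot>\<^bsub>C\<^esub> (Copy C P \<boxtimes>\<^bsub>C\<^esub> Id C K)"
    and s_T: "(Id C T \<boxtimes>\<^bsub>C\<^esub> Del C K) \<cdot>\<^bsub>C\<^esub> s = sT \<boxtimes>\<^bsub>C\<^esub> Del C K"
    and s_C: "Lunit C K \<cdot>\<^bsub>C\<^esub> (Del C T \<boxtimes>\<^bsub>C\<^esub> Id C K) \<cdot>\<^bsub>C\<^esub> s = sC"
    using parts unfolding simulator_parts_def hom_iff by blast+
  have s: "s \<in> Arr C" "Dom C s = P \<otimes>\<^bsub>C\<^esub> K" "Cod C s = T \<otimes>\<^bsub>C\<^esub> K"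
    using s_hom by (simp_all add: hom_iff)
  note [simp] = TK P sT sC s
  note [simp] = simulator_image_simps(1-3)[OF TK P s_hom]
  note image_mu = simulator_image_simps(4)[OF TK P s_hom]

  have decomp: "?s = (farr F sT \<boxtimes>\<^bsub>C'\<^esub> (farr F sC \<cdot>\<^bsub>C'\<^esub> mu F P K)) \<cdot>\<^bsub>C'\<^esub>
      Assoc C' ?P ?P ?K \<cdot>\<^bsub>C'\<^esub> (Copy C' ?P \<boxtimes>\<^bsub>C'\<^esub> Id C' ?K)"
  proof (rule target.iso_cancel_left)
    \<comment> \<open>Moving \<open>mu\<close> to the left and expanding
      \<open>farr F (Copy C P)\<close> produces the pair of \<open>mu\<close> arrows to which
      \<open>mu_Assoc\<close> applies.\<close>
    have Copy_mu: "farr F (Copy C P \<boxtimes>\<^bsub>C\<^esub> Id C K) \<cdot>\<^bsub>C'\<^esub> mu F P K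
        = mu F (P \<otimes>\<^bsub>C\<^esub> P) K \<cdot>\<^bsub>C'\<^esub> (mu F P P \<boxtimes>\<^bsub>C'\<^esub> Id C' ?K) \<cdot>\<^bsub>C'\<^esub>
            (Copy C' ?P \<boxtimes>\<^bsub>C'\<^esub> Id C' ?K)"
      by (simp add: mu_natural_eq farr_Copy farr_Id target.Tensor_Comp_eq)
    have "mu F T K \<cdot>\<^bsub>C'\<^esub> ?s
        = farr F (sT \<boxtimes>\<^bsub>C\<^esub> sC) \<cdot>\<^bsub>C'\<^esub> farr F (Assoc C P P K) \<cdot>\<^bsub>C'\<^esub>
            farr F (Copy C P \<boxtimes>\<^bsub>C\<^esub> Id C K) \<cdot>\<^bsub>C'\<^esub> mu F P K"
      unfolding image_mu by (subst s_eq) (simp add: farr_Comp_eq[symmetric])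
    also have "\<dots> = farr F (sT \<boxtimes>\<^bsub>C\<^esub> sC) \<cdot>\<^bsub>C'\<^esub>
        (farr F (Assoc C P P K) \<cdot>\<^bsub>C'\<^esub> mu F (P \<otimes>\<^bsub>C\<^esub> P) K \<cdot>\<^bsub>C'\<^esub> (mu F P P \<boxtimes>\<^bsub>C'\<^esub> Id C' ?K)) \<cdot>\<^bsub>C'\<^esub>
            (Copy C' ?P \<boxtimes>\<^bsub>C'\<^esub> Id C' ?K)"
      unfolding Copy_mu by simp
    also have "\<dots> = (farr F (sT \<boxtimes>\<^bsub>C\<^esub> sC) \<cdot>\<^bsub>C'\<^esub> mu F P (P \<otimes>\<^bsub>C\<^esub> K)) \<cdot>\<^bsub>C'\<^esub>
        (Id C' ?P \<boxtimes>\<^bsub>C'\<^esub> mu F P K) \<cdot>\<^bsub>C'\<^esub> Assoc C' ?P ?P ?K \<cdot>\<^bsub>C'\<^esub>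
            (Copy C' ?P \<boxtimes>\<^bsub>C'\<^esub> Id C' ?K)"
      unfolding mu_Assoc[OF P P TK(2)] by simp
    also have "\<dots> = mu F T K \<cdot>\<^bsub>C'\<^esub> (farr F sT \<boxtimes>\<^bsub>C'\<^esub> farr F sC) \<cdot>\<^bsub>C'\<^esub>
        (Id C' ?P \<boxtimes>\<^bsub>C'\<^esub> mu F P K) \<cdot>\<^bsub>C'\<^esub> Assoc C' ?P ?P ?K \<cdot>\<^bsub>C'\<^esub>
            (Copy C' ?P \<boxtimes>\<^bsub>C'\<^esub> Id C' ?K)"
      by (subst mu_natural_eq) simp_all
    \<comment> \<open>Interchange merges the remaining \<open>mu F P K\<close> into the second
      factor; this is why the context part is \<open>farr F sC\<close> preceded by
      \<open>mu F P K\<close>.\<close>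
    also have "\<dots> = mu F T K \<cdot>\<^bsub>C'\<^esub> (farr F sT \<boxtimes>\<^bsub>C'\<^esub> (farr F sC \<cdot>\<^bsub>C'\<^esub> mu F P K)) \<cdot>\<^bsub>C'\<^esub>
        Assoc C' ?P ?P ?K \<cdot>\<^bsub>C'\<^esub> (Copy C' ?P \<boxtimes>\<^bsub>C'\<^esub> Id C' ?K)"
      by (simp add: target.Comp_eq_extend[OF target.Tensor_Comp_eq])
    finally show "mu F T K \<cdot>\<^bsub>C'\<^esub> ?s = \<dots>" .
  qed (simp_all add: mu_iso)

  have T_part: "(Id C' ?T \<boxtimes>\<^bsub>C'\<^esub> Del C' ?K) \<cdot>\<^bsub>C'\<^esub> ?s = farr F sT \<boxtimes>\<^bsub>C'\<^esub> Del C' ?K"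
  proof -
    \<comment> \<open>The image of \<open>Del C K\<close> is \<open>eta F\<close> after the target
      \<open>Del\<close>, so both \<open>?m\<close> and \<open>?e\<close> must precede the equation
      before naturality of \<open>mu\<close> applies. They are cancelled one after the
      other.\<close>
    let ?m = "mu F T (Unit C)" and ?e = "Id C' ?T \<boxtimes>\<^bsub>C'\<^esub> eta F"
    have "?m \<cdot>\<^bsub>C'\<^esub> (?e \<cdot>\<^bsub>C'\<^esub> ((Id C' ?T \<boxtimes>\<^bsub>C'\<^esub> Del C' ?K) \<cdot>\<^bsub>C'\<^esub> ?s))
        = (?m \<cdot>\<^bsub>C'\<^esub> (farr F (Id C T) \<boxtimes>\<^bsub>C'\<^esub> farr F (Del C K))) \<cdot>\<^bsub>C'\<^esub> ?s"
      by (simp add: target.Comp_eq_extend[OF target.Tensor_Comp_eq] farr_Id farr_Del)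
    also have "\<dots> = (farr F (Id C T \<boxtimes>\<^bsub>C\<^esub> Del C K) \<cdot>\<^bsub>C'\<^esub> mu F T K) \<cdot>\<^bsub>C'\<^esub> ?s"
      by (subst mu_natural_eq) simp_all
    also have "\<dots> = farr F ((Id C T \<boxtimes>\<^bsub>C\<^esub> Del C K) \<cdot>\<^bsub>C\<^esub> s) \<cdot>\<^bsub>C'\<^esub> mu F P K"
      by (simp add: image_mu farr_Comp_eq[symmetric])
    also have "\<dots> = ?m \<cdot>\<^bsub>C'\<^esub> (farr F sT \<boxtimes>\<^bsub>C'\<^esub> farr F (Del C K))"
      unfolding s_T by (subst mu_natural_eq) simp_all
    also have "\<dots> = ?m \<cdot>\<^bsub>C'\<^esub> (?e \<cdot>\<^bsub>C'\<^esub> (farr F sT \<boxtimes>\<^bsub>C'\<^esub> Del C' ?K))"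
      by (simp add: target.Tensor_Comp_eq farr_Del)
    finally have "?e \<cdot>\<^bsub>C'\<^esub> ((Id C' ?T \<boxtimes>\<^bsub>C'\<^esub> Del C' ?K) \<cdot>\<^bsub>C'\<^esub> ?s)
        = ?e \<cdot>\<^bsub>C'\<^esub> (farr F sT \<boxtimes>\<^bsub>C'\<^esub> Del C' ?K)"
      by (rule target.iso_cancel_left) (simp_all add: mu_iso)
    then show ?thesis
      by (rule target.iso_cancel_left)
        (simp_all add: target.iso_arr_Tensor target.iso_arr_Id eta_iso)
  qed

  have C_part: "Lunit C' ?K \<cdot>\<^bsub>C'\<^esub> (Del C' ?T \<boxtimes>\<^bsub>C'\<^esub> Id C' ?K) \<cdot>\<^bsub>C'\<^esub> ?s
      = farr F sC \<cdot>\<^bsub>C'\<^esub> mu F P K"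
  proof -
    have "Lunit C' ?K \<cdot>\<^bsub>C'\<^esub> (Del C' ?T \<boxtimes>\<^bsub>C'\<^esub> Id C' ?K) \<cdot>\<^bsub>C'\<^esub> ?s
        = farr F (Lunit C K) \<cdot>\<^bsub>C'\<^esub>
            (mu F (Unit C) K \<cdot>\<^bsub>C'\<^esub> (farr F (Del C T) \<boxtimes>\<^bsub>C'\<^esub> farr F (Id C K))) \<cdot>\<^bsub>C'\<^esub> ?s"
      unfolding mu_Lunit[OF TK(2), symmetric]
      by (simp add: target.Comp_eq_extend[OF target.Tensor_Comp_eq] farr_Id farr_Del)
    also have "\<dots> = farr F (Lunit C K) \<cdot>\<^bsub>C'\<^esub>
        (farr F (Del C T \<boxtimes>\<^bsub>C\<^esub> Id C K) \<cdot>\<^bsub>C'\<^esub> mu F T K) \<cdot>\<^bsub>C'\<^esub> ?s"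
      by (subst mu_natural_eq) simp_all
    also have "\<dots> = farr F (Lunit C K \<cdot>\<^bsub>C\<^esub> (Del C T \<boxtimes>\<^bsub>C\<^esub> Id C K) \<cdot>\<^bsub>C\<^esub> s) \<cdot>\<^bsub>C'\<^esub> mu F P K"
      by (simp add: image_mu farr_Comp_eq[symmetric])
    finally show ?thesis
      unfolding s_C .
  qed

  show ?thesis
    unfolding simulator_parts_def
    by (intro conjI decomp T_part C_part functional_farr) (simp_all add: hom_iff)
qed

end

section \<open>Preservation of universal and singleton simulators\<close>

context target_context_functor
begin

text \<open>The witness is \<open>farr F r\<close>: monotonicity of \<open>F\<close> transports the
  comparison with the identity, and the coherence isomorphisms are then absorbed.\<close>

lemma universal_simulator_image:
  assumes "universal_simulator C T K geq P s"
  shows "universal_simulator C' T' K' geq' (fobj F P) (simulator_image C' F T K P s)"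
proof -
  obtain sT sC r where parts: "simulator_parts C T K P s sT sC"
    and r: "r \<in> hom C T P" "functional C r"
    and univ: "geq (s \<cdot>\<^bsub>C\<^esub> (r \<boxtimes>\<^bsub>C\<^esub> Id C K)) (Id C (T \<otimes>\<^bsub>C\<^esub> K))"
    using assms by (auto simp: universal_simulator_def simulator_def)
  have P: "P \<in> Obj C" and s: "s \<in> Arr C" "Dom C s = P \<otimes>\<^bsub>C\<^esub> K" "Cod C s = T \<otimes>\<^bsub>C\<^esub> K"
    using parts unfolding simulator_parts_def hom_iff by blast+
  have r': "r \<in> Arr C" "Dom C r = T" "Cod C r = P"
    using r by (simp_all add: hom_iff)
  note [simp] = source.T_Obj source.K_Obj P s r'
  let ?m = "mu F T K"
  note [simp] = target.inv_arr_simps[OF mu_iso[OF source.T_Obj source.K_Obj]]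
  have "geq' (inv_arr C' ?m \<cdot>\<^bsub>C'\<^esub> farr F (s \<cdot>\<^bsub>C\<^esub> (r \<boxtimes>\<^bsub>C\<^esub> Id C K)))
      (inv_arr C' ?m \<cdot>\<^bsub>C'\<^esub> farr F (Id C (T \<otimes>\<^bsub>C\<^esub> K)))"
    by (rule farr_geq[of _ "T \<otimes>\<^bsub>C\<^esub> K"]) (simp_all add: univ hom_iff)
  \<comment> \<open>Monotonicity compares arrows out of \<open>fobj F (T \<otimes> K)\<close>.
    Precomposing with \<open>?m\<close> moves the domain to the tensor of \<open>T'\<close> and
    \<open>K'\<close>, and turns the right side into an identity.\<close>
  then have "geq' ((inv_arr C' ?m \<cdot>\<^bsub>C'\<^esub> farr F (s \<cdot>\<^bsub>C\<^esub> (r \<boxtimes>\<^bsub>C\<^esub> Id C K))) \<cdot>\<^bsub>C'\<^esub> ?m)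
      ((inv_arr C' ?m \<cdot>\<^bsub>C'\<^esub> farr F (Id C (T \<otimes>\<^bsub>C\<^esub> K))) \<cdot>\<^bsub>C'\<^esub> ?m)"
    by (intro target.geq_precomp[of _ "fobj F (T \<otimes>\<^bsub>C\<^esub> K)" _ _ "T' \<otimes>\<^bsub>C'\<^esub> K'"])
      (simp_all add: hom_iff fobj_T fobj_K)
  \<comment> \<open>Naturality of \<open>mu\<close> carries \<open>?m\<close> past the image of
    \<open>r\<close> tensored with the identity, leaving the \<open>mu F P K\<close> built into
    \<open>simulator_image\<close>.\<close>
  moreover have "(inv_arr C' ?m \<cdot>\<^bsub>C'\<^esub> farr F (s \<cdot>\<^bsub>C\<^esub> (r \<boxtimes>\<^bsub>C\<^esub> Id C K))) \<cdot>\<^bsub>C'\<^esub> ?m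
      = simulator_image C' F T K P s \<cdot>\<^bsub>C'\<^esub> (farr F r \<boxtimes>\<^bsub>C'\<^esub> Id C' K')"
    by (simp add: simulator_image_def farr_Comp_eq[symmetric] mu_natural_eq farr_Id fobj_K[symmetric])
  moreover have "(inv_arr C' ?m \<cdot>\<^bsub>C'\<^esub> farr F (Id C (T \<otimes>\<^bsub>C\<^esub> K))) \<cdot>\<^bsub>C'\<^esub> ?m
      = Id C' (T' \<otimes>\<^bsub>C'\<^esub> K')"
    by (simp add: farr_Id fobj_T fobj_K)
  moreover have "farr F r \<in> hom C' T' (fobj F P)" "functional C' (farr F r)"
    using farr_hom[OF r(1)] r(2) by (simp_all add: fobj_T functional_farr)
  ultimately show ?thesis
    using simulator_parts_image[OF source.T_Obj source.K_Obj parts]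
    by (auto simp: universal_simulator_def simulator_def fobj_T fobj_K)
qed

text \<open>Expanding \<open>farr F (Del C P)\<close> leaves \<open>eta F\<close> between
  \<open>farr F t\<close> and the target \<open>Del\<close>. Absorbing it gives a state on the
  target unit, functional as a composite of functional arrows.\<close>

lemma singleton_simulator_image:
  assumes "singleton_simulator C T K P s"
  shows "singleton_simulator C' T' K' (fobj F P) (simulator_image C' F T K P s)"
proof -
  obtain sT sC t where parts: "simulator_parts C T K P s sT sC"
    and t: "t \<in> Arr C" "Dom C t = Unit C" "Cod C t = T" "functional C t"
    and sT: "sT = t \<cdot>\<^bsub>C\<^esub> Del C P"
    using assms by (auto simp: singleton_simulator_def hom_iff)
  have P: "P \<in> Obj C"
    using parts by (simp add: simulator_parts_def)
  have "farr F sT = (farr F t \<cdot>\<^bsub>C'\<^esub> eta F) \<cdot>\<^bsub>C'\<^esub> Del C' (fobj F P)"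
    using P t by (simp add: sT farr_Comp_eq[symmetric] farr_Del)
  moreover have "farr F t \<cdot>\<^bsub>C'\<^esub> eta F \<in> hom C' (Unit C') T'"
    using t by (simp add: hom_iff fobj_T)
  moreover have "functional C' (farr F t \<cdot>\<^bsub>C'\<^esub> eta F)"
    using t by (intro target.functional_Comp functional_eta functional_farr) simp_all
  ultimately show ?thesis
    using simulator_parts_image[OF source.T_Obj source.K_Obj parts]
    unfolding singleton_simulator_def fobj_T fobj_K by blast
qed

end

theorem mainTheorem10:
  fixes C :: "('o, 'm) gs_data" and T K :: 'o and geq :: "'m \<Rightarrow> 'm \<Rightarrow> bool"
    and C' :: "('p, 'n) gs_data" and T' K' :: 'p and geq' :: "'n \<Rightarrow> 'n \<Rightarrow> bool"
    and F :: "('o, 'm, 'p, 'n) functor_data"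
    and P :: 'o and s :: 'm
  assumes "target_context_category C T K geq"
    and "target_context_category C' T' K' geq'"
    and "target_context_functor C T K geq C' T' K' geq' F"
  shows "(universal_simulator C T K geq P s \<longrightarrow>
            universal_simulator C' T' K' geq' (fobj F P) (simulator_image C' F T K P s)) \<and>
         (singleton_simulator C T K P s \<longrightarrow>
            singleton_simulator C' T' K' (fobj F P) (simulator_image C' F T K P s))"
  using target_context_functor.universal_simulator_image[OF assms(3)]
    target_context_functor.singleton_simulator_image[OF assms(3)]
  by blast

end
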